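(* For any non-trivial tree $T$, $\alpha(T) = DD_{\mathrm{m}}(T)$ if and only if $T$ is a weak tree and $S(T) = |V(T)|/2$.
   Context: Graphs are finite, simple and undirected; a graph is non-trivial if it has at least two vertices. $\alpha(G)$ is the independence number. A weak graph is one in which no vertex is adjacent to two or more vertices of degree one. Swap number: a dominating set $D$ of a graph $G$ is a swap set if there is a dominating set $D'$ of $G$ with $D\cap D'=\emptyset$, $|D|=|D'|$, such that $G$ contains a perfect matching between $D$ and $D'$ (a bijection $f:D\to D'$ with $x f(x)\in E(G)$ for all $x\in D$). $DD_{\mathrm{m}}(G)$ is the minimum cardinality of a swap set of $G$, and $DD_{\mathrm{m}}(G)=\infty$ if none exists. Simple star partitioning: a star is $K_{1,n}$, $n\ge 1$; a single vertex $K_1$ is also allowed as a (degenerate) star part of order 1. A leaf is a vertex of degree one. A simple star partitioning $P$ of a non-trivial tree $T$ is a partition of $V(T)$ such that (i) each part induces a star (possibly $K_1$); (ii) each vertex of $T$ adjacent to exactly one leaf forms a $K_2$ part of $P$ together with this leaf; (iii) any $K_1$ part is adjacent to at least two parts that are not $K_1$'s (two parts are adjacent if some edge of $T$ joins them). A part of order $k$ has weight $k-1$; the weight of $P$ is the sum of the weights of its parts. $S(T)$ is the minimum weight of a simple star partitioning of $T$. *)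

theory Defs
  imports
    "HOL-Library.Disjoint_Sets"
    "HOL-Library.Extended_Nat"
    "Graph_Theory.Graph_Theory"
begin

text \<open>
  A finite simple undirected graph is a \<^const>\<open>pair_graph\<close>: a finite, symmetric, loop-free
  arc relation. The library constant \<^const>\<open>tree\<close> cannot be used for these, because it counts
  the closed walk along an arc and back as a cycle, so no symmetric graph with an edge satisfies
  it. In a loop-free graph without parallel arcs, the cycles of length at least three are exactly
  the cycles of the undirected graph.
\<close>

definition undirected_tree :: "'a pair_pre_digraph \<Rightarrow> bool" where
  "undirected_tree G \<longleftrightarrow>
     pair_graph G \<and> connected (with_proj G) \<and>
     \<not> (\<exists>p. pre_digraph.cycle (with_proj G) p \<and> 3 \<le> length p)"

definition nontrivial :: "'a pair_pre_digraph \<Rightarrow> bool" where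
  "nontrivial G \<longleftrightarrow> 2 \<le> card (pverts G)"

definition independent_set :: "'a pair_pre_digraph \<Rightarrow> 'a set \<Rightarrow> bool" where
  "independent_set G I \<longleftrightarrow> I \<subseteq> pverts G \<and> (\<forall>u\<in>I. \<forall>v\<in>I. (u, v) \<notin> parcs G)"

definition independence_number :: "'a pair_pre_digraph \<Rightarrow> nat" where
  "independence_number G = Max {card I | I. independent_set G I}"

text \<open>In a symmetric graph the out-degree is the degree of the undirected graph.\<close>

definition leaf :: "'a pair_pre_digraph \<Rightarrow> 'a \<Rightarrow> bool" where
  "leaf G v \<longleftrightarrow> v \<in> pverts G \<and> out_degree (with_proj G) v = 1"

definition adjacent_leaves :: "'a pair_pre_digraph \<Rightarrow> 'a \<Rightarrow> 'a set" where
  "adjacent_leaves G v = {u. (v, u) \<in> parcs G \<and> leaf G u}"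

definition weak_graph :: "'a pair_pre_digraph \<Rightarrow> bool" where
  "weak_graph G \<longleftrightarrow> \<not> (\<exists>v\<in>pverts G. 2 \<le> card (adjacent_leaves G v))"

definition dominating_set :: "'a pair_pre_digraph \<Rightarrow> 'a set \<Rightarrow> bool" where
  "dominating_set G D \<longleftrightarrow>
     D \<subseteq> pverts G \<and> (\<forall>v \<in> pverts G - D. \<exists>u\<in>D. (u, v) \<in> parcs G)"

definition swap_set :: "'a pair_pre_digraph \<Rightarrow> 'a set \<Rightarrow> bool" where
  "swap_set G D \<longleftrightarrow>
     dominating_set G D \<and>
     (\<exists>D'. dominating_set G D' \<and> D \<inter> D' = {} \<and> card D = card D' \<and>
       (\<exists>f. bij_betw f D D' \<and> (\<forall>x\<in>D. (x, f x) \<in> parcs G)))"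

text \<open>The infimum of the empty set of extended naturals is \<open>\<infinity>\<close>.\<close>

definition swap_number :: "'a pair_pre_digraph \<Rightarrow> enat" where
  "swap_number G = Inf {enat (card D) | D. swap_set G D}"

definition induces_star :: "'a pair_pre_digraph \<Rightarrow> 'a set \<Rightarrow> bool" where
  "induces_star G A \<longleftrightarrow> (\<exists>n\<ge>1. K\<^bsub>1,n\<^esub> (with_proj G \<restriction> A))"

definition parts_adjacent :: "'a pair_pre_digraph \<Rightarrow> 'a set \<Rightarrow> 'a set \<Rightarrow> bool" where
  "parts_adjacent G A B \<longleftrightarrow> A \<noteq> B \<and> (\<exists>u\<in>A. \<exists>v\<in>B. (u, v) \<in> parcs G)"

text \<open>
  The graph is simple, so a part is a \<open>K\<^sub>1\<close> iff it has exactly one element, and a part consisting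
  of a vertex and a leaf adjacent to it is a \<open>K\<^sub>2\<close>.
\<close>

definition simple_star_partitioning :: "'a pair_pre_digraph \<Rightarrow> 'a set set \<Rightarrow> bool" where
  "simple_star_partitioning G P \<longleftrightarrow>
     partition_on (pverts G) P \<and>
     (\<forall>A\<in>P. card A = 1 \<or> induces_star G A) \<and>
     (\<forall>v\<in>pverts G. \<forall>u. adjacent_leaves G v = {u} \<longrightarrow> {v, u} \<in> P) \<and>
     (\<forall>A\<in>P. card A = 1 \<longrightarrow> 2 \<le> card {B\<in>P. card B \<noteq> 1 \<and> parts_adjacent G A B})"

definition partitioning_weight :: "'a set set \<Rightarrow> nat" where
  "partitioning_weight P = (\<Sum>A\<in>P. card A - 1)"

text \<open>
  Every non-trivial tree has a simple star partitioning, so the minimum is taken over a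
  nonempty set: pair each vertex having exactly one leaf neighbour with that leaf, group each
  vertex having several leaf neighbours with all of them, and cover every component of order at
  least two of the rest by stars of order at least two. A remaining isolated vertex has at least
  two neighbours, which lie in different parts since the graph has no cycle.
\<close>

definition star_partition_number :: "'a pair_pre_digraph \<Rightarrow> nat" where
  "star_partition_number G =
     (LEAST w. \<exists>P. simple_star_partitioning G P \<and> partitioning_weight P = w)"

end

theory Submission
  imports Defs
begin

text \<open>
  Call a matching a swap matching if every uncovered vertex has at least two covered neighbours.
  The matching edges of a swap set form a swap matching; conversely, since a forest admits a
  two-colouring with any prescribed set of bichromatic edges, the edges of a swap matching can be
  oriented so that both sides dominate. Hence the swap number is the minimum size of a swap
  matching. A swap matching together with its uncovered vertices is a simple star partitioning of
  the same weight. In the other direction, in a weak tree, pick one edge from every star and extend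
  these edges to a maximal matching among the edges that contain a non-central vertex of a star;
  the result is a swap matching of size at most the weight, because the weight counts the
  non-central vertices.

  Let \<open>n\<close> be the order of the tree. A matching has at most \<open>n/2\<close> edges and a bipartite graph has
  independence number at least \<open>n/2\<close>, so the independence number equals the swap number iff the
  smallest swap matching has exactly \<open>n/2\<close> edges.
\<close>

section \<open>Two-colourings of forests\<close>

context pair_graph
begin

lemma rtrancl_subset_imp_awalk:
  assumes "F \<subseteq> parcs G" and "(u, v) \<in> F\<^sup>*" and "u \<in> pverts G"
  shows "\<exists>p. awalk u p v \<and> set p \<subseteq> F"
  using assms(2)
proof (induction rule: rtrancl_induct)
  case base
  then show ?case using assms(3) by (intro exI[of _ "[]"]) (auto simp: awalk_Nil_iff)
next
  case (step y z)
  then obtain p where p: "awalk u p y" "set p \<subseteq> F" by blast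
  moreover have "awalk y [(y, z)] z"
    using step.hyps(2) assms(1) by (auto simp: awalk_simps wellformed')
  ultimately have "awalk u (p @ [(y, z)]) z" by auto
  with p step.hyps(2) show ?case by (intro exI[of _ "p @ [(y, z)]"]) auto
qed

text \<open>A walk in \<open>F\<close> from \<open>u\<close> to \<open>v\<close> shortens to a path,
  which the arc \<open>(v, u)\<close> closes to a cycle. Since \<open>F\<close> avoids
  \<open>(u, v)\<close>, that cycle has length at least three.\<close>

lemma arc_not_rtrancl:
  assumes acyclic: "\<not> (\<exists>p. cycle p \<and> 3 \<le> length p)"
    and F: "F \<subseteq> parcs G" and uv: "(u, v) \<in> parcs G" "(u, v) \<notin> F"
  shows "(u, v) \<notin> F\<^sup>*"
proof
  assume "(u, v) \<in> F\<^sup>*"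
  then obtain p where p: "awalk u p v" "set p \<subseteq> F"
    using rtrancl_subset_imp_awalk[OF F] uv wellformed' by blast
  define q where "q = awalk_to_apath p"
  have q: "apath u q v" "set q \<subseteq> F"
    using apath_awalk_to_apath[OF p(1)] awalk_to_apath_subset[OF p(1)] p(2)
    by (auto simp: q_def)
  have "u \<noteq> v" using uv no_loops' by blast
  have aw: "awalk u q v" "distinct (pawalk_verts u q)"
    using q(1) by (auto simp: apath_def)
  \<comment> \<open>An empty path would give \<open>u = v\<close>, and a path of one arc would be
    \<open>(u, v)\<close> itself.\<close>
  have "2 \<le> length q"
  proof (rule ccontr)
    assume "\<not> 2 \<le> length q"
    then consider "q = []" | e where "q = [e]"
      by (cases q; cases "tl q") auto
    then show False
    proof cases
      case 1
      then show False using aw \<open>u \<noteq> v\<close> by (simp add: awalk_simps)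
    next
      case (2 e)
      then have "e = (u, v)" using aw by (cases e) (auto simp: awalk_simps)
      then show False using q(2) uv(2) 2 by auto
    qed
  qed
  moreover have "awalk v ((v, u) # q) v"
    using aw uv arcs_symmetric by (auto simp: awalk_simps wellformed')
  then have "cycle ((v, u) # q)"
    using aw(2) unfolding cycle_def by (intro exI[of _ v]) auto
  ultimately show False using acyclic by fastforce
qed

text \<open>Arcs are inserted one by one. An edge that closes no cycle joins two components, and
  flipping all colours in one of them repairs the new edge without disturbing the old ones; hence
  \<open>S\<close> can be arbitrary.\<close>

lemma signed_colouring:
  assumes acyclic: "\<not> (\<exists>p. cycle p \<and> 3 \<le> length p)"
  obtains c :: "'a \<Rightarrow> bool"
  where "\<And>u v. (u, v) \<in> parcs G \<Longrightarrow> c u \<noteq> c v \<longleftrightarrow> {u, v} \<in> S"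
proof -
  define good :: "('a \<Rightarrow> bool) \<Rightarrow> 'a rel \<Rightarrow> bool"
    where "good c A \<longleftrightarrow> (\<forall>u v. (u, v) \<in> A \<longrightarrow> (c u \<noteq> c v \<longleftrightarrow> {u, v} \<in> S))" for c A
  have "A \<subseteq> parcs G \<Longrightarrow> \<exists>c. good c A" if "finite A" for A
    using that
  proof (induction A rule: finite_induct)
    case empty
    then show ?case by (simp add: good_def)
  next
    case (insert e A)
    obtain u v where e: "e = (u, v)" by fastforce
    from insert obtain c where c: "good c A" by blast
    define F where "F = A \<union> A\<inverse>"
    have F: "F \<subseteq> parcs G" using insert.prems arcs_symmetric by (auto simp: F_def)
    show ?case
    proof (cases "(v, u) \<in> A")
      \<comment> \<open>The reverse arc already imposes the same condition, which is symmetric in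
        \<open>u\<close> and \<open>v\<close>.\<close>
      case True
      then have "c u \<noteq> c v \<longleftrightarrow> {u, v} \<in> S"
        using c unfolding good_def by (metis insert_commute)
      then have "good c (insert e A)" using c unfolding e good_def by blast
      then show ?thesis by blast
    next
      case False
      then have "(u, v) \<notin> F" using insert.hyps e by (auto simp: F_def)
      then have nr: "(u, v) \<notin> F\<^sup>*"
        using arc_not_rtrancl[OF acyclic F] insert.prems e by auto
      \<comment> \<open>The new edge joins two components; adjust the colours on one of them.\<close>
      define b where "b \<longleftrightarrow> ((c u \<noteq> c v) \<noteq> ({u, v} \<in> S))"
      define c' where "c' w = (if (u, w) \<in> F\<^sup>* then c w \<noteq> b else c w)" for w
      \<comment> \<open>\<open>F\<close> is symmetric, so the ends of an earlier arc both lie in the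
        component of \<open>u\<close> or both lie outside it; their colours flip together or not at
        all.\<close>
      have same: "(u, x) \<in> F\<^sup>* \<longleftrightarrow> (u, y) \<in> F\<^sup>*" if "(x, y) \<in> A" for x y
        using that unfolding F_def by (meson Un_iff converse_iff rtrancl.rtrancl_into_rtrancl)
      have "c' x \<noteq> c' y \<longleftrightarrow> {x, y} \<in> S" if "(x, y) \<in> A" for x y
      proof -
        have "c' x \<noteq> c' y \<longleftrightarrow> c x \<noteq> c y" using same[OF that] unfolding c'_def by argo
        then show ?thesis using c that unfolding good_def by blast
      qed
      moreover have "c' u \<longleftrightarrow> (c u \<noteq> b)" "c' v \<longleftrightarrow> c v"
        using nr unfolding c'_def by simp_all
      then have "c' u \<noteq> c' v \<longleftrightarrow> {u, v} \<in> S" unfolding b_def by argo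
      ultimately have "good c' (insert e A)" unfolding e good_def by blast
      then show ?thesis by blast
    qed
  qed
  from this[OF pair_finite_arcs order_refl] obtain c where "good c (parcs G)" by blast
  then show ?thesis unfolding good_def by (intro that[of c]) blast
qed

text \<open>Prescribing every edge to be bichromatic yields a bipartition.\<close>

lemma proper_colouring:
  assumes "\<not> (\<exists>p. cycle p \<and> 3 \<le> length p)"
  obtains c :: "'a \<Rightarrow> bool" where "\<And>u v. (u, v) \<in> parcs G \<Longrightarrow> c u \<noteq> c v"
proof (rule signed_colouring[OF assms, of UNIV])
  fix c :: "'a \<Rightarrow> bool"
  assume "\<And>u v. (u, v) \<in> parcs G \<Longrightarrow> c u \<noteq> c v \<longleftrightarrow> {u, v} \<in> UNIV"
  then show thesis by (intro that[of c]) blast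
qed

end

section \<open>Matchings\<close>

text \<open>With unordered pairs, the two opposite arcs of an undirected edge count once.\<close>

definition edge_set :: "'a pair_pre_digraph \<Rightarrow> 'a set set" where
  "edge_set G = {{u, v} |u v. (u, v) \<in> parcs G}"

definition matching :: "'a pair_pre_digraph \<Rightarrow> 'a set set \<Rightarrow> bool" where
  "matching G M \<longleftrightarrow> M \<subseteq> edge_set G \<and> disjoint M"

text \<open>The sides of a swap set are not recorded; in a forest a suitable colouring recovers
  them.\<close>

definition swap_matching :: "'a pair_pre_digraph \<Rightarrow> 'a set set \<Rightarrow> bool" where
  "swap_matching G M \<longleftrightarrow> matching G M \<and>
     (\<forall>v\<in>pverts G - \<Union>M. \<exists>a\<in>\<Union>M. \<exists>b\<in>\<Union>M. a \<noteq> b \<and> (v, a) \<in> parcs G \<and> (v, b) \<in> parcs G)"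

lemma matching_unique:
  assumes "matching G M" "e \<in> M" "e' \<in> M" "x \<in> e" "x \<in> e'"
  shows "e = e'"
  using assms by (auto simp: matching_def disjoint_def)

lemma swap_matchingE:
  assumes "swap_matching G M" "v \<in> pverts G" "v \<notin> \<Union>M"
  obtains a b where "a \<in> \<Union>M" "b \<in> \<Union>M" "a \<noteq> b" "(v, a) \<in> parcs G" "(v, b) \<in> parcs G"
  using assms unfolding swap_matching_def by (meson DiffI)

context pair_graph
begin

lemma edge_set_iff: "{u, v} \<in> edge_set G \<longleftrightarrow> (u, v) \<in> parcs G"
  using arcs_symmetric by (auto simp: edge_set_def doubleton_eq_iff)

lemma card_edge: "e \<in> edge_set G \<Longrightarrow> card e = 2"
  by (auto simp: edge_set_def card_2_iff dest: no_loops')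

lemma edge_subset_verts: "e \<in> edge_set G \<Longrightarrow> e \<subseteq> pverts G"
  by (auto simp: edge_set_def wellformed')

lemma finite_edge_set: "finite (edge_set G)"
  using edge_subset_verts finite_subset[of "edge_set G" "Pow (pverts G)"] pair_finite_verts by auto

lemma matching_finite: "matching G M \<Longrightarrow> finite M"
  using finite_edge_set finite_subset by (auto simp: matching_def)

lemma matching_Union_subset: "matching G M \<Longrightarrow> \<Union>M \<subseteq> pverts G"
  using edge_subset_verts by (auto simp: matching_def)

lemma card_Union_matching:
  assumes "matching G M"
  shows "card (\<Union>M) = 2 * card M"
proof -
  have "card (\<Union>M) = sum card M"
    using assms finite_subset[OF edge_subset_verts pair_finite_verts]
    by (intro card_Union_disjoint) (auto simp: matching_def)
  also have "\<dots> = (\<Sum>e\<in>M. 2)"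
    using assms card_edge by (intro sum.cong) (auto simp: matching_def)
  finally show ?thesis by simp
qed

lemma card_matching_le:
  assumes "matching G M"
  shows "2 * card M \<le> card (pverts G)"
  using card_Union_matching[OF assms] matching_Union_subset[OF assms] pair_finite_verts
  by (metis card_mono)

lemma matching_edgeE:
  assumes "matching G M" "x \<in> \<Union>M"
  obtains y where "{x, y} \<in> M" "(x, y) \<in> parcs G"
proof -
  from assms(2) obtain e where e: "e \<in> M" "x \<in> e" by blast
  then have ee: "e \<in> edge_set G" using assms(1) by (auto simp: matching_def)
  then obtain u v where uv: "e = {u, v}" unfolding edge_set_def by blast
  then consider "x = u" | "x = v" using e(2) by blast
  then show ?thesis
  proof cases
    case 1
    then show ?thesis using that[of v] uv e ee edge_set_iff by blast
  next
    case 2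
    then show ?thesis using that[of u] uv e ee edge_set_iff by (metis insert_commute)
  qed
qed

text \<open>Disjointness of the edges makes any choice of partners an involution, so
  \<open>f\<close> can serve as its own inverse when it exchanges the two sides of a swap
  set.\<close>

lemma matching_partner:
  assumes "matching G M"
  obtains f where "\<And>x. x \<in> \<Union>M \<Longrightarrow> {x, f x} \<in> M" "\<And>x. x \<in> \<Union>M \<Longrightarrow> (x, f x) \<in> parcs G"
    "\<And>x. x \<in> \<Union>M \<Longrightarrow> f (f x) = x"
proof -
  have "\<exists>f. \<forall>x\<in>\<Union>M. {x, f x} \<in> M \<and> (x, f x) \<in> parcs G"
    by (intro bchoice ballI) (meson matching_edgeE[OF assms])
  then obtain f where f: "\<And>x. x \<in> \<Union>M \<Longrightarrow> {x, f x} \<in> M \<and> (x, f x) \<in> parcs G"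
    by blast
  have "f (f x) = x" if "x \<in> \<Union>M" for x
  proof -
    have fx: "f x \<in> \<Union>M" using f[OF that] by blast
    have "{x, f x} = {f x, f (f x)}"
      using matching_unique[OF assms, of "{x, f x}" "{f x, f (f x)}" "f x"] f[OF that] f[OF fx]
      by blast
    then show ?thesis by (auto simp: doubleton_eq_iff)
  qed
  then show ?thesis using that f by blast
qed

text \<open>There are finitely many matchings between \<open>M\<^sub>0\<close> and \<open>F\<close>.
  In a maximal one, an edge of \<open>F\<close> with both ends uncovered could still be
  added.\<close>

lemma maximal_matching:
  assumes "matching G M\<^sub>0" and "M\<^sub>0 \<subseteq> F" and "F \<subseteq> edge_set G"
  obtains M where "matching G M" "M\<^sub>0 \<subseteq> M" "M \<subseteq> F"
    "\<And>u v. {u, v} \<in> F \<Longrightarrow> u \<notin> \<Union>M \<Longrightarrow> v \<in> \<Union>M"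
proof -
  define \<M> where "\<M> = {M. matching G M \<and> M\<^sub>0 \<subseteq> M \<and> M \<subseteq> F}"
  have "\<M> \<subseteq> Pow (edge_set G)" by (auto simp: \<M>_def matching_def)
  then have "finite \<M>" by (rule finite_subset) (simp add: finite_edge_set)
  moreover have "M\<^sub>0 \<in> \<M>" using assms by (simp add: \<M>_def)
  ultimately obtain M where M: "M \<in> \<M>" and max: "\<And>M'. M' \<in> \<M> \<Longrightarrow> M \<subseteq> M' \<Longrightarrow> M = M'"
    by (metis finite_has_maximal2)
  have "v \<in> \<Union>M" if "{u, v} \<in> F" "u \<notin> \<Union>M" for u v
  proof (rule ccontr)
    assume "v \<notin> \<Union>M"
    then have "insert {u, v} M \<in> \<M>"
      using M that assms(3) by (auto simp: \<M>_def matching_def disjoint_def)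
    then have "{u, v} \<in> M" using max by blast
    then show False using that(2) by blast
  qed
  then show ?thesis using that[of M] M by (auto simp: \<M>_def)
qed

section \<open>Leaves, weak graphs and the existence of swap matchings\<close>

lemma leaf_iff: "leaf G v \<longleftrightarrow> (\<exists>!u. (v, u) \<in> parcs G)"
proof -
  have "out_arcs (with_proj G) v = Pair v ` {u. (v, u) \<in> parcs G}"
    unfolding out_arcs_def with_proj_simps by force
  then have "out_degree (with_proj G) v = card {u. (v, u) \<in> parcs G}"
    by (simp add: out_degree_def card_image inj_on_def)
  then have "out_degree (with_proj G) v = 1 \<longleftrightarrow> (\<exists>u. {u. (v, u) \<in> parcs G} = {u})"
    by (simp add: card_1_singleton_iff)
  also have "\<dots> \<longleftrightarrow> (\<exists>!u. (v, u) \<in> parcs G)" by (auto simp: set_eq_iff)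
  finally show ?thesis unfolding leaf_def using wellformed' by blast
qed

lemma leaf_unique: "leaf G v \<Longrightarrow> (v, a) \<in> parcs G \<Longrightarrow> (v, b) \<in> parcs G \<Longrightarrow> a = b"
  unfolding leaf_iff by blast

lemma not_leafE:
  assumes "\<not> leaf G v" "(v, a) \<in> parcs G"
  obtains b where "b \<noteq> a" "(v, b) \<in> parcs G"
  using assms unfolding leaf_iff Ex1_def by blast

lemma adjacent_leavesD:
  assumes "u \<in> adjacent_leaves G v"
  shows "leaf G u" "(v, u) \<in> parcs G" "(u, v) \<in> parcs G"
  using assms arcs_symmetric unfolding adjacent_leaves_def by blast+

lemma finite_adjacent_leaves: "finite (adjacent_leaves G v)"
  using pair_finite_verts by (rule finite_subset[rotated]) (auto simp: adjacent_leaves_def leaf_def)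

lemma weak_graph_iff:
  "weak_graph G \<longleftrightarrow> (\<forall>v u w. u \<in> adjacent_leaves G v \<longrightarrow> w \<in> adjacent_leaves G v \<longrightarrow> u = w)"
proof -
  have "\<not> 2 \<le> card (adjacent_leaves G v) \<longleftrightarrow>
      (\<forall>u w. u \<in> adjacent_leaves G v \<longrightarrow> w \<in> adjacent_leaves G v \<longrightarrow> u = w)" for v
    using card_le_Suc0_iff_eq[OF finite_adjacent_leaves[of v]]
    by (simp add: Suc_1[symmetric] not_less_eq_eq del: Suc_1) blast
  \<comment> \<open>This allows the quantifier over \<open>v\<close> to be unbounded.\<close>
  moreover have "adjacent_leaves G v = {}" if "v \<notin> pverts G" for v
    using that adjacent_leavesD(2) wellformed'(1) by blast
  ultimately show ?thesis unfolding weak_graph_def by (metis empty_iff)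
qed

lemma weak_graphD:
  "weak_graph G \<Longrightarrow> u \<in> adjacent_leaves G v \<Longrightarrow> w \<in> adjacent_leaves G v \<Longrightarrow> u = w"
  unfolding weak_graph_iff by blast

text \<open>A leaf cannot have two covered neighbours, so it is covered itself, necessarily by its
  only edge.\<close>

lemma swap_matching_leaf_edge:
  assumes "swap_matching G M" "u \<in> adjacent_leaves G v"
  shows "{v, u} \<in> M"
proof -
  note u = adjacent_leavesD[OF assms(2)]
  have "u \<in> \<Union>M"
  proof (rule ccontr)
    assume "u \<notin> \<Union>M"
    from swap_matchingE[OF assms(1) wellformed'(1)[OF u(3)] this]
    obtain a b where "a \<noteq> b" "(u, a) \<in> parcs G" "(u, b) \<in> parcs G" .
    then show False using leaf_unique[OF u(1)] by blast
  qed
  moreover have "matching G M" using assms(1) by (simp add: swap_matching_def)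
  ultimately obtain y where y: "{u, y} \<in> M" "(u, y) \<in> parcs G"
    using matching_edgeE by blast
  then have "y = v" using leaf_unique u by blast
  then show ?thesis using y by (simp add: insert_commute)
qed

text \<open>Two leaves at \<open>v\<close> would give two matching edges meeting in
  \<open>v\<close>.\<close>

lemma swap_matching_imp_weak_graph:
  assumes "swap_matching G M"
  shows "weak_graph G"
  unfolding weak_graph_iff
proof (intro allI impI)
  fix v u w assume "u \<in> adjacent_leaves G v" "w \<in> adjacent_leaves G v"
  then have "{v, u} \<in> M" "{v, w} \<in> M" using swap_matching_leaf_edge[OF assms] by auto
  then have "{v, u} = {v, w}"
    using matching_unique assms unfolding swap_matching_def by (metis insertI1)
  then show "u = w" by (auto simp: doubleton_eq_iff)
qed

text \<open>In a weak graph the leaf edges form a matching; extend it to a maximal one. An uncovered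
  vertex is then no leaf, so it has two neighbours, and maximality covers both.\<close>

lemma weak_graph_imp_swap_matching:
  assumes "weak_graph G" and deg: "\<And>v. v \<in> pverts G \<Longrightarrow> \<exists>u. (v, u) \<in> parcs G"
  obtains M where "swap_matching G M"
proof -
  define M\<^sub>0 where "M\<^sub>0 = {{v, u} |v u. u \<in> adjacent_leaves G v}"
  have leaf_edge: "e = {x, y}" if xe: "e \<in> M\<^sub>0" "x \<in> e" "y \<in> adjacent_leaves G x" for e x y
  proof -
    from xe obtain v u where e: "e = {v, u}" "u \<in> adjacent_leaves G v" by (auto simp: M\<^sub>0_def)
    consider "x = v" | "x = u" using e(1) xe(2) by blast
    then show ?thesis
    proof cases
      case 1
      then show ?thesis using weak_graphD[OF assms(1)] e xe(3) by blast
    next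
      \<comment> \<open>Here \<open>x\<close> is a leaf with a leaf neighbour, so its only neighbour
        is both \<open>v\<close> and \<open>y\<close>.\<close>
      case 2
      then have "leaf G x" "(x, v) \<in> parcs G" "(x, y) \<in> parcs G"
        using adjacent_leavesD[OF e(2)] adjacent_leavesD[OF xe(3)] by auto
      then have "v = y" by (rule leaf_unique)
      then show ?thesis using 2 e by blast
    qed
  qed
  have "e = e'" if ee: "e \<in> M\<^sub>0" "e' \<in> M\<^sub>0" "x \<in> e" "x \<in> e'" for e e' x
  proof -
    from ee obtain v u where e: "e = {v, u}" "u \<in> adjacent_leaves G v" by (auto simp: M\<^sub>0_def)
    from ee obtain v' u' where e': "e' = {v', u'}" "u' \<in> adjacent_leaves G v'" by (auto simp: M\<^sub>0_def)
    \<comment> \<open>A shared vertex is either the supporting end of one of the edges, which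
      \<open>leaf_edge\<close> settles, or the leaf end of both.\<close>
    consider "x = v" | "x = v'" | "x = u" "x = u'" using e(1) e'(1) ee(3,4) by blast
    then show ?thesis
    proof cases
      case 1
      then show ?thesis using leaf_edge[of e' x u] e ee by simp
    next
      case 2
      then show ?thesis using leaf_edge[of e x u'] e' ee by simp
    next
      case 3
      then have "leaf G x" "(x, v) \<in> parcs G" "(x, v') \<in> parcs G"
        using adjacent_leavesD[OF e(2)] adjacent_leavesD[OF e'(2)] by auto
      then have "v = v'" by (rule leaf_unique)
      then show ?thesis using 3 e e' by blast
    qed
  qed
  moreover have "M\<^sub>0 \<subseteq> edge_set G" by (auto simp: M\<^sub>0_def edge_set_def adjacent_leaves_def)
  ultimately have "matching G M\<^sub>0" by (auto simp: matching_def disjoint_def)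
  then obtain M where M: "matching G M" "M\<^sub>0 \<subseteq> M"
    and max: "\<And>u v. {u, v} \<in> edge_set G \<Longrightarrow> u \<notin> \<Union>M \<Longrightarrow> v \<in> \<Union>M"
    using maximal_matching[OF _ \<open>M\<^sub>0 \<subseteq> edge_set G\<close> order_refl] by metis
  have "\<exists>a\<in>\<Union>M. \<exists>b\<in>\<Union>M. a \<noteq> b \<and> (v, a) \<in> parcs G \<and> (v, b) \<in> parcs G"
    if v: "v \<in> pverts G - \<Union>M" for v
  proof -
    obtain a where a: "(v, a) \<in> parcs G" using deg v by blast
    have "\<not> leaf G v"
    proof
      assume "leaf G v"
      then have "v \<in> adjacent_leaves G a"
        using arcs_symmetric[OF a] by (simp add: adjacent_leaves_def)
      then have "{a, v} \<in> M\<^sub>0" unfolding M\<^sub>0_def by blast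
      then show False using v M(2) by blast
    qed
    then obtain b where "b \<noteq> a" "(v, b) \<in> parcs G" using not_leafE a by metis
    then show ?thesis using a max[of v] v edge_set_iff by (metis DiffD2)
  qed
  then show ?thesis using that[of M] M(1) unfolding swap_matching_def by blast
qed

end

section \<open>Swap sets and swap matchings\<close>

lemma dominating_setE:
  assumes "dominating_set G D" "v \<in> pverts G" "v \<notin> D"
  obtains u where "u \<in> D" "(u, v) \<in> parcs G"
  using assms unfolding dominating_set_def by blast

context pair_graph
begin

text \<open>A vertex outside both sides is dominated from \<open>D\<close> and from
  \<open>D'\<close>; as these are disjoint, the two dominating neighbours differ.\<close>

lemma swap_set_imp_swap_matching:
  assumes "swap_set G D"
  obtains M where "swap_matching G M" "card M = card D"
proof -
  from assms obtain D' f where D: "dominating_set G D" "dominating_set G D'" "D \<inter> D' = {}"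
    and f: "bij_betw f D D'" "\<And>x. x \<in> D \<Longrightarrow> (x, f x) \<in> parcs G"
    unfolding swap_set_def by blast
  have fD: "f x \<in> D'" "f x \<notin> D" "x \<notin> D'" if "x \<in> D" for x
    using that f(1) D(3) by (auto simp: bij_betw_def)
  have finj: "x = y" if "x \<in> D" "y \<in> D" "f x = f y" for x y
    using that f(1) by (auto simp: bij_betw_def inj_on_def)
  define M where "M = (\<lambda>x. {x, f x}) ` D"
  \<comment> \<open>This gives the disjointness of \<open>M\<close> and also the injectivity behind
    \<open>card M = card D\<close>.\<close>
  have meet: "x = y" if "x \<in> D" "y \<in> D" "{x, f x} \<inter> {y, f y} \<noteq> {}" for x y
    using that fD[of x] fD[of y] finj[of x y] by blast
  have "M \<subseteq> edge_set G" using f(2) by (auto simp: M_def edge_set_def)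
  moreover have "disjoint M"
  proof (rule disjointI)
    fix e e' assume "e \<in> M" "e' \<in> M" "e \<noteq> e'"
    then obtain x y where "x \<in> D" "y \<in> D" "e = {x, f x}" "e' = {y, f y}" "x \<noteq> y"
      unfolding M_def by blast
    then show "e \<inter> e' = {}" using meet by metis
  qed
  ultimately have mM: "matching G M" by (simp add: matching_def)
  have UM: "\<Union>M = D \<union> D'" using f(1) by (auto simp: M_def bij_betw_def)
  have "\<exists>a\<in>\<Union>M. \<exists>b\<in>\<Union>M. a \<noteq> b \<and> (v, a) \<in> parcs G \<and> (v, b) \<in> parcs G"
    if v: "v \<in> pverts G - \<Union>M" for v
  proof -
    obtain a where a: "a \<in> D" "(a, v) \<in> parcs G" using dominating_setE[OF D(1)] v UM by blast
    obtain b where b: "b \<in> D'" "(b, v) \<in> parcs G" using dominating_setE[OF D(2)] v UM by blast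
    show ?thesis
    proof (intro bexI conjI)
      show "a \<noteq> b" using a(1) b(1) D(3) by blast
      show "a \<in> \<Union>M" "b \<in> \<Union>M" unfolding UM using a(1) b(1) by simp_all
    qed (use arcs_symmetric a b in blast)+
  qed
  then have "swap_matching G M" using mM unfolding swap_matching_def by blast
  moreover have "card M = card D"
    unfolding M_def using meet by (intro card_image inj_onI) blast
  ultimately show ?thesis by (rule that)
qed

text \<open>In a colouring that makes matching edges bichromatic, the covered vertices of each
  colour form one side. A covered vertex is dominated by its partner on the other side.\<close>

lemma swap_matching_imp_swap_set:
  assumes acyclic: "\<not> (\<exists>p. cycle p \<and> 3 \<le> length p)" and M: "swap_matching G M"
  obtains D where "swap_set G D" "card D = card M"
proof -
  have mM: "matching G M" using M by (simp add: swap_matching_def)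
  have "\<forall>v\<in>pverts G - \<Union>M. \<exists>ab. fst ab \<in> \<Union>M \<and> snd ab \<in> \<Union>M \<and> fst ab \<noteq> snd ab
      \<and> (v, fst ab) \<in> parcs G \<and> (v, snd ab) \<in> parcs G"
    using M unfolding swap_matching_def split_paired_Ex fst_conv snd_conv by blast
  from bchoice[OF this] obtain ab where ab: "\<And>v. v \<in> pverts G - \<Union>M \<Longrightarrow>
      fst (ab v) \<in> \<Union>M \<and> snd (ab v) \<in> \<Union>M \<and> fst (ab v) \<noteq> snd (ab v)
      \<and> (v, fst (ab v)) \<in> parcs G \<and> (v, snd (ab v)) \<in> parcs G"
    by blast
  \<comment> \<open>Every uncovered vertex gets the colour of one chosen covered neighbour and the opposite
    colour of another one, so that it sees both colours.\<close>
  define S where "S = M \<union> {{v, snd (ab v)} |v. v \<in> pverts G - \<Union>M}"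
  obtain c :: "'a \<Rightarrow> bool" where c: "\<And>u v. (u, v) \<in> parcs G \<Longrightarrow> c u \<noteq> c v \<longleftrightarrow> {u, v} \<in> S"
    by (rule signed_colouring[OF acyclic, of S]) metis
  obtain f where f: "\<And>x. x \<in> \<Union>M \<Longrightarrow> {x, f x} \<in> M" "\<And>x. x \<in> \<Union>M \<Longrightarrow> (x, f x) \<in> parcs G"
    "\<And>x. x \<in> \<Union>M \<Longrightarrow> f (f x) = x"
    by (rule matching_partner[OF mM]) metis
  have fM: "f x \<in> \<Union>M" if "x \<in> \<Union>M" for x using f(1)[OF that] by blast
  have cf: "c (f x) \<longleftrightarrow> \<not> c x" if "x \<in> \<Union>M" for x
    using c[OF f(2)[OF that]] f(1)[OF that] unfolding S_def by blast
  have cab: "c (snd (ab v)) \<longleftrightarrow> \<not> c v" "c (fst (ab v)) \<longleftrightarrow> c v" if v: "v \<in> pverts G - \<Union>M" for v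
  proof -
    show "c (snd (ab v)) \<longleftrightarrow> \<not> c v" using c[of v "snd (ab v)"] ab[OF v] v unfolding S_def by blast
    \<comment> \<open>It is no matching edge, as \<open>v\<close> is uncovered. If it were the
      chosen edge of some \<open>w\<close>, then either \<open>w = v\<close> and the two chosen
      neighbours agree, or \<open>w\<close> is the covered vertex \<open>fst (ab v)\<close>.\<close>
    have "{v, fst (ab v)} \<notin> S"
    proof
      assume "{v, fst (ab v)} \<in> S"
      then consider "{v, fst (ab v)} \<in> M"
        | w where "w \<in> pverts G - \<Union>M" "{v, fst (ab v)} = {w, snd (ab w)}"
        unfolding S_def by blast
      then show False
      proof cases
        case 1
        then show False using v by blast
      next
        case (2 w)
        then show False using ab[OF v] by (metis DiffD2 doubleton_eq_iff)
      qed
    qed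
    then show "c (fst (ab v)) \<longleftrightarrow> c v" using c[of v "fst (ab v)"] ab[OF v] by blast
  qed
  define D where "D b = {x\<in>\<Union>M. c x = b}" for b
  have UM: "\<Union>M \<subseteq> pverts G" by (rule matching_Union_subset[OF mM])
  have dom: "dominating_set G (D b)" for b
    unfolding dominating_set_def
  proof (intro conjI ballI)
    show "D b \<subseteq> pverts G" using UM by (auto simp: D_def)
    fix v assume v: "v \<in> pverts G - D b"
    show "\<exists>u\<in>D b. (u, v) \<in> parcs G"
    proof (cases "v \<in> \<Union>M")
      case True
      then have "c v \<noteq> b" using v by (auto simp: D_def)
      then have "f v \<in> D b" using cf[OF True] fM[OF True] unfolding D_def by auto
      then show ?thesis using arcs_symmetric[OF f(2)[OF True]] by blast
    next
      case False
      then have v': "v \<in> pverts G - \<Union>M" using v by blast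
      have "fst (ab v) \<in> D b \<or> snd (ab v) \<in> D b"
        using ab[OF v'] cab[OF v'] unfolding D_def by blast
      then show ?thesis using ab[OF v'] arcs_symmetric by blast
    qed
  qed
  have bij: "bij_betw f (D True) (D False)"
    by (rule bij_betw_byWitness[where f' = f]) (use f(3) fM cf in \<open>auto simp: D_def\<close>)
  have "finite (\<Union>M)" using UM pair_finite_verts finite_subset by blast
  moreover have "\<Union>M = D True \<union> D False" "D True \<inter> D False = {}" by (auto simp: D_def)
  ultimately have "2 * card M = card (D True) + card (D False)"
    using card_Union_matching[OF mM] card_Un_disjoint[of "D True" "D False"] by auto
  then have "card (D True) = card M" using bij_betw_same_card[OF bij] by simp
  moreover have "swap_set G (D True)"
    unfolding swap_set_def
  proof (intro conjI exI)
    show "D True \<inter> D False = {}" by (auto simp: D_def)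
    show "\<forall>x\<in>D True. (x, f x) \<in> parcs G" using f(2) by (auto simp: D_def)
  qed (use dom bij bij_betw_same_card[OF bij] in auto)
  ultimately show ?thesis using that by blast
qed

section \<open>Star partitionings and swap matchings\<close>

text \<open>Loop-freeness leaves only the two opposite arcs in the induced subgraph, which is thus
  K2, with two singleton sides.\<close>

lemma induces_star_edge:
  assumes "(u, v) \<in> parcs G"
  shows "induces_star G {u, v}"
proof -
  have "u \<noteq> v" using assms no_loops' by blast
  let ?H = "\<lparr>pverts = {u, v}, parcs = {(u, v), (v, u)}\<rparr>"
  have "with_proj G \<restriction> {u, v} = with_proj ?H"
    using assms arcs_symmetric[OF assms] no_loops'[of u u] no_loops'[of v v]
    by (auto simp: induce_subgraph_def with_proj_def)
  moreover have "K\<^bsub>1,1\<^esub> (with_proj ?H)"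
    unfolding complete_bipartite_digraph_pair_def using \<open>u \<noteq> v\<close>
    by (intro conjI exI[of _ "{u}"] exI[of _ "{v}"]) auto
  ultimately show ?thesis unfolding induces_star_def by auto
qed

text \<open>The centre \<open>c\<close> is the side of size one; \<open>m\<close> exists because the
  other side has \<open>n \<ge> 1\<close> elements.\<close>

lemma induces_starE:
  assumes "induces_star G A"
  obtains c m where "c \<in> A" "m \<in> A" "m \<noteq> c" "\<And>u. u \<in> A \<Longrightarrow> u \<noteq> c \<Longrightarrow> (c, u) \<in> parcs G"
proof -
  from assms obtain n where "n \<ge> 1" and K: "K\<^bsub>1,n\<^esub> (with_proj G \<restriction> A)"
    unfolding induces_star_def by blast
  from K obtain U V where UV: "A = U \<union> V" "U \<inter> V = {}" "card U = 1" "card V = n"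
    and arcs: "arcs_ends (with_proj G \<restriction> A) = U \<times> V \<union> V \<times> U"
    unfolding complete_bipartite_digraph_def by auto
  obtain c where c: "U = {c}" using UV(3) card_1_singletonE by blast
  obtain m where m: "m \<in> V" using UV(4) \<open>n \<ge> 1\<close> by fastforce
  have "(c, u) \<in> parcs G" if "u \<in> A" "u \<noteq> c" for u
  proof -
    have "(c, u) \<in> arcs_ends (with_proj G \<restriction> A)" using that arcs UV c by blast
    then show ?thesis by (auto simp: arcs_ends_def arc_to_ends_def)
  qed
  then show ?thesis using that[of c m] c m UV by blast
qed

text \<open>Take the matching edges, of weight one each, and the uncovered vertices as singletons of
  weight zero. Leaf edges lie in every swap matching, which gives the condition on K2 parts.\<close>

lemma swap_matching_imp_star_partitioning:
  assumes acyclic: "\<not> (\<exists>p. cycle p \<and> 3 \<le> length p)" and M: "swap_matching G M"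
  obtains P where "simple_star_partitioning G P" "partitioning_weight P = card M"
proof -
  have mM: "matching G M" using M by (simp add: swap_matching_def)
  have UM: "\<Union>M \<subseteq> pverts G" by (rule matching_Union_subset[OF mM])
  have M2: "card e = 2" "\<exists>u v. e = {u, v} \<and> (u, v) \<in> parcs G" if "e \<in> M" for e
    using that mM card_edge[of e] unfolding matching_def edge_set_def by auto
  obtain c :: "'a \<Rightarrow> bool" where c: "\<And>u v. (u, v) \<in> parcs G \<Longrightarrow> c u \<noteq> c v"
    by (rule proper_colouring[OF acyclic]) metis
  define R where "R = (\<lambda>r. {r}) ` (pverts G - \<Union>M)"
  define P where "P = M \<union> R"
  have finR: "finite R" using pair_finite_verts by (simp add: R_def)
  have finM: "finite M" by (rule matching_finite[OF mM])
  have MR: "M \<inter> R = {}" using M2(1) by (fastforce simp: R_def)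
  have "partition_on (pverts G) P"
  proof (rule partition_onI)
    show "\<Union>P = pverts G" using UM by (auto simp: P_def R_def)
    show "{} \<notin> P" using M2(1) by (fastforce simp: P_def R_def)
    show "disjnt p q" if "p \<in> P" "q \<in> P" "p \<noteq> q" for p q
      using that matching_unique[OF mM] unfolding P_def R_def disjnt_def by blast
  qed
  moreover have "card A = 1 \<or> induces_star G A" if "A \<in> P" for A
    using that M2(2)[of A] induces_star_edge by (auto simp: P_def R_def)
  moreover have "{v, u} \<in> P" if "adjacent_leaves G v = {u}" for v u
    using swap_matching_leaf_edge[OF M, of u v] that by (simp add: P_def)
  moreover have "2 \<le> card {B\<in>P. card B \<noteq> 1 \<and> parts_adjacent G A B}"
    if A: "A \<in> P" "card A = 1" for A
  proof -
    have "A \<in> R" using A M2(1)[of A] by (auto simp: P_def)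
    then obtain v where v: "v \<in> pverts G" "v \<notin> \<Union>M" "A = {v}" unfolding R_def by blast
    obtain a b where ab: "a \<in> \<Union>M" "b \<in> \<Union>M" "a \<noteq> b" "(v, a) \<in> parcs G" "(v, b) \<in> parcs G"
      by (rule swap_matchingE[OF M v(1,2)])
    obtain e where e: "e \<in> M" "a \<in> e" using ab by blast
    obtain e' where e': "e' \<in> M" "b \<in> e'" using ab by blast
    \<comment> \<open>Otherwise \<open>v\<close>, \<open>a\<close> and \<open>b\<close> would form a
      triangle, which has no proper two-colouring.\<close>
    have "e \<noteq> e'"
    proof
      assume "e = e'"
      then have "(a, b) \<in> parcs G \<or> (b, a) \<in> parcs G" using M2(2)[OF e(1)] e e' ab(3) by blast
      then show False using c[OF ab(4)] c[OF ab(5)] c[of a b] c[of b a] by blast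
    qed
    have "{e, e'} \<subseteq> {B\<in>P. card B \<noteq> 1 \<and> parts_adjacent G A B}"
      using e e' ab v M2(1)[OF e(1)] M2(1)[OF e'(1)] unfolding P_def parts_adjacent_def by auto
    moreover have "finite {B\<in>P. card B \<noteq> 1 \<and> parts_adjacent G A B}"
      using finM finR by (simp add: P_def)
    ultimately have "card {e, e'} \<le> card {B\<in>P. card B \<noteq> 1 \<and> parts_adjacent G A B}"
      by (rule card_mono[rotated])
    then show ?thesis using \<open>e \<noteq> e'\<close> by simp
  qed
  ultimately have "simple_star_partitioning G P" unfolding simple_star_partitioning_def by blast
  moreover have "partitioning_weight P = (\<Sum>A\<in>M. card A - 1) + (\<Sum>A\<in>R. card A - 1)"
    unfolding partitioning_weight_def P_def by (rule sum.union_disjoint[OF finM finR MR])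
  moreover have "(\<Sum>A\<in>M. card A - 1) = (\<Sum>A\<in>M. 1)" using M2(1) by (intro sum.cong) auto
  moreover have "(\<Sum>A\<in>R. card A - 1) = 0" by (auto simp: R_def)
  ultimately show ?thesis using that by auto
qed

text \<open>Centres are covered by \<open>M\<^sub>0\<close>, and maximality covers every neighbour
  of an uncovered vertex as soon as one of the two lies in \<open>N\<close>. An uncovered vertex is
  a K1 part, which sees two stars, or a non-central vertex, which sees its centre and, not being a
  leaf, something else.\<close>

lemma star_partitioning_imp_swap_matching:
  assumes weak: "weak_graph G" and P: "simple_star_partitioning G P"
  obtains M where "swap_matching G M" "card M \<le> partitioning_weight P"
proof -
  have part: "partition_on (pverts G) P" and star: "\<And>A. A \<in> P \<Longrightarrow> card A = 1 \<or> induces_star G A"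
    and K2: "\<And>v u. v \<in> pverts G \<Longrightarrow> adjacent_leaves G v = {u} \<Longrightarrow> {v, u} \<in> P"
    and K1: "\<And>A. A \<in> P \<Longrightarrow> card A = 1 \<Longrightarrow> 2 \<le> card {B\<in>P. card B \<noteq> 1 \<and> parts_adjacent G A B}"
    using P unfolding simple_star_partitioning_def by blast+
  have uniq: "A = B" if "A \<in> P" "B \<in> P" "x \<in> A" "x \<in> B" for A B x
    using that partition_onD2[OF part] by (auto simp: disjoint_def)
  have finP: "finite P" using finite_elements[OF pair_finite_verts part] .
  have finA: "finite A" if "A \<in> P" for A
    using that partition_onD1[OF part] pair_finite_verts finite_subset[of A "pverts G"] by blast
  define Q where "Q = {A\<in>P. card A \<noteq> 1}"
  have "\<forall>A\<in>Q. \<exists>cm. fst cm \<in> A \<and> snd cm \<in> A \<and> snd cm \<noteq> fst cm \<and>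
      (\<forall>u\<in>A. u \<noteq> fst cm \<longrightarrow> (fst cm, u) \<in> parcs G)"
  proof
    fix A assume "A \<in> Q"
    then have "induces_star G A" using star by (auto simp: Q_def)
    then obtain c m where "c \<in> A" "m \<in> A" "m \<noteq> c" "\<And>u. u \<in> A \<Longrightarrow> u \<noteq> c \<Longrightarrow> (c, u) \<in> parcs G"
      by (rule induces_starE) metis
    then show "\<exists>cm. fst cm \<in> A \<and> snd cm \<in> A \<and> snd cm \<noteq> fst cm \<and>
        (\<forall>u\<in>A. u \<noteq> fst cm \<longrightarrow> (fst cm, u) \<in> parcs G)"
      by (intro exI[of _ "(c, m)"]) auto
  qed
  from bchoice[OF this] obtain cm where cm: "\<And>A. A \<in> Q \<Longrightarrow> fst (cm A) \<in> A \<and> snd (cm A) \<in> A \<and>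
      snd (cm A) \<noteq> fst (cm A) \<and> (\<forall>u\<in>A. u \<noteq> fst (cm A) \<longrightarrow> (fst (cm A), u) \<in> parcs G)"
    by blast
  define c where "c A = fst (cm A)" for A
  define m where "m A = snd (cm A)" for A
  have c: "c A \<in> A" "m A \<in> A" "m A \<noteq> c A" "\<And>u. u \<in> A \<Longrightarrow> u \<noteq> c A \<Longrightarrow> (c A, u) \<in> parcs G"
    if "A \<in> Q" for A
    using cm[OF that] by (auto simp: c_def m_def)
  \<comment> \<open>There are as many non-central vertices of stars as the weight of the partitioning.\<close>
  define N where "N = (\<Union>A\<in>Q. A - {c A})"
  have finN: "finite N" using finP finA by (auto simp: N_def Q_def)
  have "card N = (\<Sum>A\<in>Q. card (A - {c A}))"
    unfolding N_def
  proof (rule card_UN_disjoint)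
    show "\<forall>A\<in>Q. \<forall>B\<in>Q. A \<noteq> B \<longrightarrow> (A - {c A}) \<inter> (B - {c B}) = {}"
      using uniq unfolding Q_def by blast
  qed (use finP finA in \<open>auto simp: Q_def\<close>)
  also have "\<dots> = (\<Sum>A\<in>Q. card A - 1)"
    by (intro sum.cong) (use c(1) in auto)
  also have "\<dots> = partitioning_weight P"
    unfolding partitioning_weight_def Q_def using finP by (intro sum.mono_neutral_left) auto
  finally have cardN: "card N = partitioning_weight P" .
  define M\<^sub>0 where "M\<^sub>0 = (\<lambda>A. {c A, m A}) ` Q"
  \<comment> \<open>Disjoint edges that all meet \<open>N\<close> inject into \<open>N\<close>, so a
    matching inside \<open>F\<close> has at most \<open>card N\<close> edges.\<close>
  define F where "F = {e\<in>edge_set G. e \<inter> N \<noteq> {}}"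
  have "M\<^sub>0 \<subseteq> F"
  proof
    fix e assume "e \<in> M\<^sub>0"
    then obtain A where A: "A \<in> Q" "e = {c A, m A}" unfolding M\<^sub>0_def by blast
    then have "e \<in> edge_set G" using c[OF A(1)] edge_set_iff by simp
    moreover have "m A \<in> N" using A c[OF A(1)] unfolding N_def by blast
    ultimately show "e \<in> F" using A by (auto simp: F_def)
  qed
  moreover have "F \<subseteq> edge_set G" by (auto simp: F_def)
  moreover have "disjoint M\<^sub>0"
  proof (rule disjointI)
    fix e e' assume "e \<in> M\<^sub>0" "e' \<in> M\<^sub>0" "e \<noteq> e'"
    then obtain A B where AB: "A \<in> Q" "B \<in> Q" "A \<noteq> B" "e = {c A, m A}" "e' = {c B, m B}"
      unfolding M\<^sub>0_def by blast
    then have "e \<subseteq> A" "e' \<subseteq> B" using c by auto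
    then show "e \<inter> e' = {}" using uniq AB unfolding Q_def by blast
  qed
  ultimately have "matching G M\<^sub>0" by (auto simp: matching_def)
  then obtain M where M: "matching G M" "M\<^sub>0 \<subseteq> M" "M \<subseteq> F"
    and max: "\<And>u v. {u, v} \<in> F \<Longrightarrow> u \<notin> \<Union>M \<Longrightarrow> v \<in> \<Union>M"
    using maximal_matching[OF _ \<open>M\<^sub>0 \<subseteq> F\<close> \<open>F \<subseteq> edge_set G\<close>] by metis
  have cov: "c A \<in> \<Union>M" "m A \<in> \<Union>M" if "A \<in> Q" for A
    using that M(2) unfolding M\<^sub>0_def by blast+
  have nbr: "x \<in> \<Union>M" if "(v, x) \<in> parcs G" "v \<notin> \<Union>M" "v \<in> N \<or> x \<in> N" for v x
    using max[of v x] that edge_set_iff[of v x] unfolding F_def by blast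
  have "\<exists>a\<in>\<Union>M. \<exists>b\<in>\<Union>M. a \<noteq> b \<and> (v, a) \<in> parcs G \<and> (v, b) \<in> parcs G"
    if v: "v \<in> pverts G" "v \<notin> \<Union>M" for v
  proof -
    obtain A where A: "A \<in> P" "v \<in> A" using v(1) partition_onD1[OF part] by blast
    show ?thesis
    proof (cases "card A = 1")
      case True
      then have Av: "A = {v}" using A(2) by (metis card_1_singletonE singletonD)
      define X where "X = {B\<in>P. card B \<noteq> 1 \<and> parts_adjacent G A B}"
      have "\<not> card X \<le> Suc 0" using K1[OF A(1) True] unfolding X_def by linarith
      moreover have "finite X" using finP by (simp add: X_def)
      ultimately obtain B B' where B: "B \<in> X" "B' \<in> X" "B \<noteq> B'"
        using card_le_Suc0_iff_eq by blast
      \<comment> \<open>The neighbour in \<open>B\<close> is the centre, covered by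
        \<open>M\<^sub>0\<close>, or belongs to \<open>N\<close> and is covered by
        maximality.\<close>
      have covX: "\<exists>x\<in>B. x \<in> \<Union>M \<and> (v, x) \<in> parcs G" if "B \<in> X" for B
      proof -
        from that obtain x where x: "x \<in> B" "(v, x) \<in> parcs G"
          unfolding X_def parts_adjacent_def Av by blast
        have BQ: "B \<in> Q" using that by (simp add: X_def Q_def)
        have "x \<in> \<Union>M"
        proof (cases "x = c B")
          case True
          then show ?thesis using cov(1)[OF BQ] by simp
        next
          case False
          then have "x \<in> N" using x(1) BQ unfolding N_def by blast
          then show ?thesis using nbr x(2) v(2) by blast
        qed
        then show ?thesis using x by blast
      qed
      obtain a where a: "a \<in> B" "a \<in> \<Union>M" "(v, a) \<in> parcs G" using covX[OF B(1)] by blast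
      obtain b where b: "b \<in> B'" "b \<in> \<Union>M" "(v, b) \<in> parcs G" using covX[OF B(2)] by blast
      have "a \<noteq> b" using uniq[of B B' a] a(1) b(1) B unfolding X_def by blast
      then show ?thesis using a b by blast
    next
      case False
      then have AQ: "A \<in> Q" using A(1) by (simp add: Q_def)
      have vc: "v \<noteq> c A" "v \<noteq> m A" using cov[OF AQ] v(2) by auto
      then have vN: "v \<in> N" using A(2) AQ unfolding N_def by blast
      have cv: "(c A, v) \<in> parcs G" using c(4)[OF AQ A(2) vc(1)] .
      \<comment> \<open>As a leaf, \<open>v\<close> would be the only leaf at \<open>c A\<close> by
        weakness, so \<open>A\<close> would be \<open>{c A, v}\<close>, leaving no room for
        \<open>m A\<close>.\<close>
      have "\<not> leaf G v"
      proof
        assume "leaf G v"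
        then have "v \<in> adjacent_leaves G (c A)" using cv by (simp add: adjacent_leaves_def)
        then have "adjacent_leaves G (c A) = {v}" using weak_graphD[OF weak] by blast
        then have "{c A, v} \<in> P" using K2 wellformed'(1)[OF cv] by blast
        then have "{c A, v} = A" using uniq A by blast
        then show False using c(2,3)[OF AQ] vc by blast
      qed
      then obtain b where "b \<noteq> c A" "(v, b) \<in> parcs G"
        using not_leafE arcs_symmetric[OF cv] by metis
      then show ?thesis using nbr vN v(2) arcs_symmetric[OF cv] by metis
    qed
  qed
  then have "swap_matching G M" using M(1) unfolding swap_matching_def by blast
  moreover have "card M \<le> card N"
  proof -
    have "\<forall>e\<in>M. \<exists>x. x \<in> e \<inter> N" using M(3) unfolding F_def by blast
    from bchoice[OF this] obtain g where g: "\<And>e. e \<in> M \<Longrightarrow> g e \<in> e \<inter> N" by blast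
    have "inj_on g M"
    proof (rule inj_onI)
      fix e e' assume e: "e \<in> M" "e' \<in> M" "g e = g e'"
      then have "g e \<in> e" "g e \<in> e'" using g[OF e(1)] g[OF e(2)] by auto
      then show "e = e'" using matching_unique[OF M(1) e(1,2)] by blast
    qed
    moreover have "g ` M \<subseteq> N" using g by blast
    ultimately show ?thesis using finN by (rule card_inj_on_le)
  qed
  ultimately show ?thesis using that cardN by simp
qed

section \<open>The independence number\<close>

lemma finite_independent_cards: "finite {card I |I. independent_set G I}"
proof -
  have "{card I |I. independent_set G I} \<subseteq> card ` Pow (pverts G)"
    by (auto simp: independent_set_def)
  then show ?thesis using pair_finite_verts by (meson finite_Pow_iff finite_imageI finite_subset)
qed

text \<open>Both classes of a bipartition are independent, and together they contain all
  vertices.\<close>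

lemma card_le_two_independence_number:
  assumes "\<not> (\<exists>p. cycle p \<and> 3 \<le> length p)"
  shows "card (pverts G) \<le> 2 * independence_number G"
proof -
  obtain c :: "'a \<Rightarrow> bool" where c: "\<And>u v. (u, v) \<in> parcs G \<Longrightarrow> c u \<noteq> c v"
    by (rule proper_colouring[OF assms]) metis
  define C where "C b = {v\<in>pverts G. c v = b}" for b
  have "independent_set G (C b)" for b
    using c unfolding independent_set_def C_def by blast
  then have "card (C b) \<le> independence_number G" for b
    unfolding independence_number_def by (intro Max_ge finite_independent_cards) blast
  from this[of True] this[of False]
  have "card (C True) + card (C False) \<le> 2 * independence_number G" by simp
  moreover have "card (pverts G) \<le> card (C True) + card (C False)"
  proof -
    have "pverts G = C True \<union> C False" by (auto simp: C_def)
    then show ?thesis by (metis card_Un_le)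
  qed
  ultimately show ?thesis by linarith
qed

text \<open>The matching covers every vertex, and an independent set contains at most one end of
  each edge.\<close>

lemma independence_number_le_perfect_matching:
  assumes M: "matching G M" "2 * card M = card (pverts G)"
  shows "independence_number G \<le> card M"
proof -
  have UM: "\<Union>M = pverts G"
    using card_subset_eq[OF pair_finite_verts matching_Union_subset[OF M(1)]]
      card_Union_matching[OF M(1)] M(2) by simp
  have "card I \<le> card M" if I: "independent_set G I" for I
  proof -
    have "\<forall>x\<in>I. \<exists>e. e \<in> M \<and> x \<in> e" using I UM unfolding independent_set_def by blast
    from bchoice[OF this] obtain g where g: "\<And>x. x \<in> I \<Longrightarrow> g x \<in> M \<and> x \<in> g x" by blast
    have "inj_on g I"
    proof (rule inj_onI)
      fix x y assume xy: "x \<in> I" "y \<in> I" "g x = g y"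
      then have "g x \<in> edge_set G" "x \<in> g x" "y \<in> g x"
        using g[OF xy(1)] g[OF xy(2)] M(1) by (auto simp: matching_def)
      then obtain u v where "(u, v) \<in> parcs G" "x \<in> {u, v}" "y \<in> {u, v}"
        unfolding edge_set_def by blast
      then show "x = y" using I xy unfolding independent_set_def by blast
    qed
    moreover have "g ` I \<subseteq> M" using g by blast
    ultimately show ?thesis using matching_finite[OF M(1)] by (rule card_inj_on_le)
  qed
  moreover have "independent_set G {}" by (simp add: independent_set_def)
  ultimately show ?thesis
    unfolding independence_number_def using finite_independent_cards
    by (intro Max.boundedI) auto
qed

lemma connected_imp_neighbour:
  assumes "connected (with_proj G)" "2 \<le> card (pverts G)" "v \<in> pverts G"
  shows "\<exists>u. (v, u) \<in> parcs G"
proof -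
  have "\<not> pverts G \<subseteq> {v}"
  proof
    assume "pverts G \<subseteq> {v}"
    then have "card (pverts G) \<le> 1" using card_mono[of "{v}" "pverts G"] by simp
    then show False using assms(2) by simp
  qed
  then obtain w where w: "w \<in> pverts G" "w \<noteq> v" by blast
  have "v \<rightarrow>\<^sup>*\<^bsub>with_proj (mk_symmetric (with_proj G))\<^esub> w"
    using assms w unfolding connected_def strongly_connected_def by (auto simp: mk_symmetric_def)
  \<comment> \<open>Connectedness is defined through the symmetric closure, which adds nothing here.
    The neighbour is the first step of a walk to another vertex \<open>w\<close>.\<close>
  moreover have "parcs (mk_symmetric (with_proj G)) = parcs G"
    using arcs_symmetric unfolding mk_symmetric_def by force
  ultimately have "(v, w) \<in> (parcs G)\<^sup>*"
    unfolding reachable_def with_proj_simps by (metis rtrancl_on_rtranclI)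
  then show ?thesis using w(2) by (metis converse_rtranclE)
qed

end

section \<open>Comparison of the independence number, the swap number and the star partition
  number\<close>

theorem theorem24:
  fixes T :: "'a pair_pre_digraph"
  assumes "undirected_tree T" and "nontrivial T"
  shows "enat (independence_number T) = swap_number T \<longleftrightarrow>
    weak_graph T \<and> real (star_partition_number T) = real (card (pverts T)) / 2"
proof -
  interpret pair_graph T using assms(1) by (simp add: undirected_tree_def)
  have acyclic: "\<not> (\<exists>p. cycle p \<and> 3 \<le> length p)" and conn: "connected (with_proj T)"
    using assms(1) by (auto simp: undirected_tree_def)
  define n where "n = card (pverts T)"
  \<comment> \<open>\<open>LEAST\<close> is attained once some partitioning exists; a swap matching
    supplies one.\<close>
  have S_attained: "\<exists>P. simple_star_partitioning T P \<and> partitioning_weight P = star_partition_number T"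
    and S_le: "star_partition_number T \<le> card M" if M: "swap_matching T M" for M
  proof -
    obtain P where P: "simple_star_partitioning T P" "partitioning_weight P = card M"
      using swap_matching_imp_star_partitioning[OF acyclic M] .
    show "\<exists>P. simple_star_partitioning T P \<and> partitioning_weight P = star_partition_number T"
      unfolding star_partition_number_def by (rule LeastI) (use P in blast)
    show "star_partition_number T \<le> card M"
      unfolding star_partition_number_def by (rule Least_le) (use P in blast)
  qed
  have swap_number: "swap_number T = Inf {enat (card M) |M. swap_matching T M}"
  proof -
    have "{enat (card D) |D. swap_set T D} = {enat (card M) |M. swap_matching T M}"
      using swap_set_imp_swap_matching swap_matching_imp_swap_set[OF acyclic]
      by (auto, metis+)
    then show ?thesis by (simp add: swap_number_def)
  qed
  have M_le: "2 * card M \<le> n" if "swap_matching T M" for M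
    using that card_matching_le unfolding swap_matching_def n_def by blast
  have alpha_ge: "n \<le> 2 * independence_number T"
    using card_le_two_independence_number[OF acyclic] by (simp add: n_def)
  show ?thesis
  proof
    assume eq: "enat (independence_number T) = swap_number T"
    \<comment> \<open>An empty set would have infimum \<open>\<infinity>\<close>, but the
      independence number is finite.\<close>
    have "{enat (card M) |M. swap_matching T M} \<noteq> {}"
    proof
      assume "{enat (card M) |M. swap_matching T M} = {}"
      then show False using eq unfolding swap_number by (simp add: Inf_enat_def)
    qed
    then have "swap_number T \<in> {enat (card M) |M. swap_matching T M}"
      unfolding swap_number using wellorder_InfI by (metis (no_types, lifting) ex_in_conv)
    then obtain M where M: "swap_matching T M" "card M = independence_number T"
      using eq by auto
    have min: "card M \<le> card M'" if "swap_matching T M'" for M'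
    proof -
      have "swap_number T \<le> enat (card M')" unfolding swap_number using that by (intro Inf_lower) blast
      then show ?thesis using eq M(2) by (metis enat_ord_simps(1))
    qed
    \<comment> \<open>The independence number is at least \<open>n/2\<close>, and a matching has at
      most \<open>n/2\<close> edges.\<close>
    have n: "2 * card M = n" using M_le[OF M(1)] alpha_ge M(2) by linarith
    have weak: "weak_graph T" by (rule swap_matching_imp_weak_graph[OF M(1)])
    obtain P where P: "simple_star_partitioning T P" "partitioning_weight P = star_partition_number T"
      using S_attained[OF M(1)] by blast
    \<comment> \<open>The chain from \<open>card M'\<close> to
      \<open>star_partition_number T\<close> to \<open>card M\<close> is nondecreasing, and
      minimality of \<open>M\<close> makes it collapse.\<close>
    obtain M' where "swap_matching T M'" "card M' \<le> star_partition_number T"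
      using star_partitioning_imp_swap_matching[OF weak P(1)] P(2) by metis
    then have "star_partition_number T = card M" using min S_le[OF M(1)] by fastforce
    then show "weak_graph T \<and> real (star_partition_number T) = real (card (pverts T)) / 2"
      using weak n unfolding n_def[symmetric] by (simp add: field_simps flip: n)
  next
    assume R: "weak_graph T \<and> real (star_partition_number T) = real (card (pverts T)) / 2"
    then have "real (2 * star_partition_number T) = real n" by (simp add: n_def)
    then have S: "2 * star_partition_number T = n" by (simp only: of_nat_eq_iff)
    \<comment> \<open>The star partition number \<open>n/2\<close> is a lower bound for swap
      matchings and \<open>n/2\<close> is also an upper bound for matchings, so every swap matching
      is perfect.\<close>
    have card_M: "2 * card M = n" if "swap_matching T M" for M
      using S_le[OF that] M_le[OF that] S by linarith
    obtain M where M: "swap_matching T M"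
      using weak_graph_imp_swap_matching R connected_imp_neighbour[OF conn] assms(2)
      unfolding nontrivial_def by metis
    have same: "card M' = card M" if "swap_matching T M'" for M'
      using card_M[OF that] card_M[OF M] by linarith
    have "{enat (card M') |M'. swap_matching T M'} = {enat (card M)}"
    proof (intro equalityI subsetI)
      fix x assume "x \<in> {enat (card M') |M'. swap_matching T M'}"
      then obtain M' where "x = enat (card M')" "swap_matching T M'" by blast
      then show "x \<in> {enat (card M)}" using same by simp
    qed (use M in blast)
    then have "swap_number T = enat (card M)" by (simp add: swap_number)
    moreover have "independence_number T \<le> card M"
      using independence_number_le_perfect_matching M card_M[OF M]
      unfolding swap_matching_def n_def by blast
    ultimately show "enat (independence_number T) = swap_number T"
      using alpha_ge card_M[OF M] by simp
  qed
qed

end
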